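(* Let $p$ be a positive integer. There exists a constant $c>0$ such that, for all sufficiently large $n$, \[ \mathbb E\bigl(|Df_0(Q_n)|^p\bigr)\le c\,(\log n)^{p+1-\frac1{d-1}}\left(\frac1n\right)^{1-\frac1{d-1}}. \]
   Context: Fix an integer $d\ge4$ and set $\beta=\frac d2-2$. Let $\mathbb B^2$ be the closed unit disk in $\mathbb R^2$ and $\mu$ the probability measure on $\mathbb B^2$ with density $\frac{\beta+1}{\pi}(1-\|x\|^2)^\beta$. Let $X_1,\dots,X_n$ be independent random points with law $\mu$, $Q_n=\mathrm{conv}(X_1,\dots,X_n)$, and $f_0$ denote the number of vertices. The first order difference is $Df_0(Q_n)=f_0(\mathrm{conv}(X_1,\dots,X_n))-f_0(\mathrm{conv}(X_2,\dots,X_n))$ (by symmetry, removing any one point gives the same distribution). *)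

theory Defs
  imports "HOL-Probability.Probability"
begin

definition beta_exponent :: "nat \<Rightarrow> real" where
  "beta_exponent d = real d / 2 - 2"

text \<open>On the unit circle, \<open>0 powr 0 = 0\<close> differs from the usual convention \<open>0\<^sup>0 = 1\<close> when
  the exponent is \<open>0\<close>; this only changes the density on a Lebesgue null set.\<close>

definition beta_law :: "real \<Rightarrow> (real ^ 2) measure" where
  "beta_law \<beta> = density lborel
     (\<lambda>x. ennreal (indicator (cball 0 1) x * ((\<beta> + 1) / pi * (1 - (norm x)\<^sup>2) powr \<beta>)))"

definition f0 :: "(real ^ 2) set \<Rightarrow> nat" where
  "f0 P = card {v. v extreme_point_of P}"

definition random_sample ::
    "(real ^ 2) measure \<Rightarrow> nat \<Rightarrow> 'a measure \<Rightarrow> (nat \<Rightarrow> 'a \<Rightarrow> real ^ 2) \<Rightarrow> bool" where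
  "random_sample \<mu> n M X \<longleftrightarrow>
     prob_space M \<and>
     prob_space.indep_vars M (\<lambda>_. borel) X {1..n} \<and>
     (\<forall>i\<in>{1..n}. distr M borel (X i) = \<mu>)"

definition Df0 :: "nat \<Rightarrow> (nat \<Rightarrow> real ^ 2) \<Rightarrow> real" where
  "Df0 n x = real (f0 (convex hull (x ` {1..n}))) - real (f0 (convex hull (x ` {2..n})))"

end

theory Submission
  imports Defs "HOL-Real_Asymp.Real_Asymp"
begin

text \<open>Put \<open>\<epsilon> = (A ln n / n) powr (2 / (d - 1))\<close>, so that a cap of height \<open>\<epsilon>\<close> has measure of order
  \<open>ln n / n\<close>. If each of \<open>n\<close> equally spaced caps of height \<open>\<epsilon>\<close> contains one of \<open>X\<^sub>2, \<dots>, X\<^sub>n\<close>, then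
  the convex hull of these points contains the disk of radius \<open>r = 1 - 5 \<epsilon>\<close>; for large \<open>A\<close> this fails
  with probability at most \<open>n powr - (p + 1)\<close>, where \<open>|Df0| \<le> n\<close> suffices. Otherwise \<open>Df0\<close>
  vanishes unless \<open>|X\<^sub>1| > r\<close>, an event of probability of order \<open>\<epsilon> powr (d / 2 - 1)\<close>. In that case a
  vertex \<open>v\<close> can only be lost if the midpoint of \<open>X\<^sub>1\<close> and \<open>v\<close> is outside the hull, hence has norm
  above \<open>r\<close>, which forces \<open>v\<close> into a cap of height \<open>20 \<epsilon>\<close> in the direction of \<open>X\<^sub>1\<close>. The number \<open>N\<close> of
  sample points in that cap is conditionally binomial with mean of order \<open>ln n\<close>, and
  \<open>E (1 + N)^p \<le> p! (ln n)^p E exp ((1 + N) / ln n)\<close> is of order \<open>(ln n)^p\<close>.\<close>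

section \<open>Orthonormal frames and areas of rotated rectangles\<close>

definition perp :: "real ^ 2 \<Rightarrow> real ^ 2" where
  "perp u = vector [- (u $ 2), u $ 1]"

lemma inner_perp_square_sum:
  assumes "norm u = 1"
  shows "(u \<bullet> y)\<^sup>2 + (perp u \<bullet> y)\<^sup>2 = (norm y)\<^sup>2"
proof -
  have u: "(u $ 1)\<^sup>2 + (u $ 2)\<^sup>2 = 1"
    using assms by (simp add: norm_vec_def L2_set_def sum_2)
  have "(u \<bullet> y)\<^sup>2 + (perp u \<bullet> y)\<^sup>2 = ((u $ 1)\<^sup>2 + (u $ 2)\<^sup>2) * ((y $ 1)\<^sup>2 + (y $ 2)\<^sup>2)"
    by (simp add: inner_vec_def sum_2 perp_def power2_eq_square algebra_simps)
  also have "\<dots> = (norm y)\<^sup>2"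
    by (simp add: u norm_vec_def L2_set_def sum_2)
  finally show ?thesis .
qed

text \<open>The rectangle is the image of an axis-parallel box under the map \<open>f\<close> that
  sends the standard frame to \<open>u\<close>, \<open>perp u\<close>; \<open>g\<close> reads off
  the coordinates in that frame and inverts \<open>f\<close>. Since \<open>f\<close> is orthogonal,
  it preserves Lebesgue measure. Caps will be compared with such rectangles from inside and from
  outside.\<close>

lemma emeasure_lborel_rotated_rectangle:
  assumes u: "norm u = 1" and "a \<le> b" "c \<le> d"
  shows "emeasure lborel {y. a \<le> u \<bullet> y \<and> u \<bullet> y \<le> b \<and> c \<le> perp u \<bullet> y \<and> perp u \<bullet> y \<le> d}
    = ennreal ((b - a) * (d - c))"
proof -
  have uu: "u $ 1 * u $ 1 + u $ 2 * u $ 2 = 1"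
    using u by (simp add: norm_vec_def L2_set_def sum_2 power2_eq_square)
  define f where "f y = (y $ 1) *\<^sub>R u + (y $ 2) *\<^sub>R perp u" for y :: "real ^ 2"
  define g where "g y = (vector [u \<bullet> y, perp u \<bullet> y] :: real ^ 2)" for y
  have gf: "g (f y) = y" for y
    unfolding f_def g_def vec_eq_iff forall_2
    using uu by (simp add: inner_vec_def sum_2 perp_def) algebra
  have fg: "f (g y) = y" for y
    unfolding f_def g_def vec_eq_iff forall_2
    using uu by (simp add: inner_vec_def sum_2 perp_def) algebra
  have "linear f"
    unfolding f_def by (intro linearI) (simp_all add: algebra_simps)
  moreover have "norm (f y) = norm y" for y
  proof -
    have "(norm (f y))\<^sup>2 = (norm y)\<^sup>2"
      using inner_perp_square_sum[OF u, of "f y"] gf[of y]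
      by (simp add: g_def vec_eq_iff forall_2 norm_vec_def L2_set_def sum_2)
    then show ?thesis by simp
  qed
  ultimately have f: "orthogonal_transformation f"
    by (simp add: orthogonal_transformation)
  let ?R = "{y. a \<le> u \<bullet> y \<and> u \<bullet> y \<le> b \<and> c \<le> perp u \<bullet> y \<and> perp u \<bullet> y \<le> d}"
  let ?B = "cbox (vector [a, c]) (vector [b, d] :: real ^ 2)"
  have B: "?B \<noteq> {}"
    using assms by (simp add: interval_ne_empty_cart forall_2)
  have mem: "y \<in> ?R \<longleftrightarrow> g y \<in> ?B" for y
    by (auto simp: g_def mem_box_cart forall_2)
  have R: "?R = f ` ?B"
  proof (intro equalityI subsetI)
    fix y assume "y \<in> ?R"
    then have "g y \<in> ?B" by (simp only: mem)
    then show "y \<in> f ` ?B" using fg[of y] by (metis imageI)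
  next
    fix y assume "y \<in> f ` ?B"
    then have "g y \<in> ?B" using gf by auto
    then show "y \<in> ?R" by (simp only: mem)
  qed
  have "measure lebesgue ?R = measure lebesgue ?B"
    unfolding R by (rule measure_orthogonal_image[OF f]) simp
  also have "\<dots> = (b - a) * (d - c)"
    using content_cbox_cart[OF B] by (simp add: UNIV_2)
  finally have m: "measure lebesgue ?R = (b - a) * (d - c)" .
  have "?R \<in> lmeasurable"
    unfolding R by (rule measurable_orthogonal_image[OF f]) simp
  then have "emeasure lebesgue ?R = ennreal ((b - a) * (d - c))"
    using m by (simp add: emeasure_eq_measure2)
  moreover have "?R \<in> sets borel"
    by measurable
  ultimately show ?thesis
    by simp
qed

section \<open>Change of the vertex number when one point is added\<close>

text \<open>If \<open>v\<close> stopped being extreme, it would lie on a segment from \<open>x\<close> to some \<open>b\<close> in the old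
  hull, hence strictly between \<open>b\<close> and the midpoint.\<close>

lemma extreme_point_of_convex_hull_insert_midpoint:
  fixes x v :: "'a::euclidean_space"
  assumes S: "finite S" and v: "v extreme_point_of (convex hull S)"
    and m: "midpoint x v \<in> convex hull S"
  shows "v extreme_point_of (convex hull (insert x S))"
proof (cases "v = x")
  case True
  then show ?thesis
    using v extreme_point_of_convex_hull[OF v] by (simp add: insert_absorb)
next
  case False
  have vS: "v \<in> S" by (rule extreme_point_of_convex_hull[OF v])
  \<comment> \<open>Removing an extreme point keeps the hull convex, so \<open>v\<close> is not in
    the hull of the remaining points of \<open>S\<close>; this gives \<open>b \<noteq> v\<close>
    below.\<close>
  have "convex (convex hull S - {v})"
    using v by (simp add: extreme_point_of_stillconvex)
  moreover have "S - {v} \<subseteq> convex hull S - {v}"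
    using hull_subset[of S convex] by auto
  ultimately have sub: "convex hull (S - {v}) \<subseteq> convex hull S - {v}"
    by (rule hull_minimal[rotated])
  have "v \<notin> convex hull (insert x (S - {v}))"
  proof
    assume *: "v \<in> convex hull (insert x (S - {v}))"
    have "S - {v} \<noteq> {}"
    proof
      assume "S - {v} = {}"
      with * False show False by (simp only: convex_hull_singleton singleton_iff)
    qed
    with * obtain s b where sb: "0 \<le> s" "s \<le> 1" "b \<in> convex hull (S - {v})"
      "v = (1 - s) *\<^sub>R x + s *\<^sub>R b"
      unfolding convex_hull_insert_alt by auto
    have b: "b \<in> convex hull S" "b \<noteq> v" using sb(3) sub by auto
    have s: "0 < s" "s < 1"
      using sb(1,2,4) b(2) False by (auto simp: order_less_le)
    \<comment> \<open>Substituting \<open>x = 2 *\<^sub>R midpoint x v - v\<close> into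
      \<open>v = (1 - s) *\<^sub>R x + s *\<^sub>R b\<close> and solving for \<open>v\<close> gives
      weights \<open>2 * (1 - s) / (2 - s)\<close> on the midpoint and \<open>s / (2 - s)\<close> on
      \<open>b\<close>.\<close>
    define t where "t = s / (2 - s)"
    have t: "0 < t" "t < 1" using s by (auto simp: t_def field_simps)
    have "(2 - s) *\<^sub>R v = (2 - s) *\<^sub>R ((1 - t) *\<^sub>R midpoint x v + t *\<^sub>R b)"
    proof -
      have e: "(2 - s) * t = s" "(2 - s) * (1 - t) = 2 * (1 - s)"
        using s by (auto simp: t_def field_simps)
      have "(2 - s) *\<^sub>R ((1 - t) *\<^sub>R midpoint x v + t *\<^sub>R b)
          = (2 * (1 - s)) *\<^sub>R midpoint x v + s *\<^sub>R b"
        by (simp add: scaleR_add_right e)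
      also have "\<dots> = ((1 - s) *\<^sub>R x + s *\<^sub>R b) + (1 - s) *\<^sub>R v"
        by (simp add: midpoint_def algebra_simps)
      also have "\<dots> = (2 - s) *\<^sub>R v"
        unfolding sb(4)[symmetric] by (simp add: algebra_simps scaleR_2)
      finally show ?thesis by (rule sym)
    qed
    then have vt: "v = (1 - t) *\<^sub>R midpoint x v + t *\<^sub>R b"
      using s by (metis scaleR_left_imp_eq diff_gt_0_iff_gt less_trans one_less_numeral_iff semiring_norm(76) less_irrefl)
    have "midpoint x v \<noteq> b"
    proof
      assume "midpoint x v = b"
      with vt have "v = b" by (metis scaleR_left_distrib diff_add_cancel scaleR_one)
      with b show False by simp
    qed
    with vt t have "v \<in> open_segment (midpoint x v) b"
      by (auto simp: in_segment)
    with v m b show False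
      unfolding extreme_point_of_def by blast
  qed
  then have "v extreme_point_of (convex hull (insert v (insert x (S - {v}))))"
    using S by (intro extreme_point_of_convex_hull_insert) auto
  moreover have "insert v (insert x (S - {v})) = insert x S"
    using vS by auto
  ultimately show ?thesis by simp
qed

lemma f0_convex_hull_le:
  assumes "finite S"
  shows "f0 (convex hull S) \<le> card S"
  unfolding f0_def by (rule card_mono[OF assms extreme_points_of_convex_hull])

text \<open>At most one vertex is gained, namely \<open>x\<close>: an extreme point of the larger
  hull that lies in the smaller hull is extreme there too. By the midpoint criterion, only vertices
  whose midpoint with \<open>x\<close> leaves the old hull can be lost.\<close>

lemma f0_convex_hull_insert_diff:
  assumes S: "finite S"
  shows "\<bar>real (f0 (convex hull (insert x S))) - real (f0 (convex hull S))\<bar>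
    \<le> 1 + real (card {v \<in> S. midpoint x v \<notin> convex hull S})"
proof -
  let ?V = "{v. v extreme_point_of (convex hull S)}"
  let ?V' = "{v. v extreme_point_of (convex hull (insert x S))}"
  let ?W = "{v \<in> S. midpoint x v \<notin> convex hull S}"
  have VS: "?V \<subseteq> S" by (rule extreme_points_of_convex_hull)
  have fin: "finite ?V" using S VS finite_subset by blast
  have fin': "finite ?V'"
    using S extreme_points_of_convex_hull[of "insert x S"] finite_subset by blast
  have "?V' \<subseteq> insert x ?V"
  proof
    fix v assume "v \<in> ?V'"
    then have v: "v extreme_point_of (convex hull (insert x S))" by simp
    show "v \<in> insert x ?V"
    proof (cases "v = x")
      case False
      then have "v \<in> S" using extreme_point_of_convex_hull[OF v] by simp
      then have "v \<in> convex hull S" by (rule hull_inc)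
      moreover have "convex hull S \<subseteq> convex hull (insert x S)"
        by (rule hull_mono) auto
      ultimately show ?thesis
        using v unfolding extreme_point_of_def by blast
    qed simp
  qed
  then have "card ?V' \<le> card (insert x ?V)"
    using fin by (intro card_mono) auto
  also have "\<dots> \<le> 1 + card ?V"
    using card_insert_le_m1[of "Suc (card ?V)" ?V x] by simp
  finally have 1: "card ?V' \<le> 1 + card ?V" .
  have "?V \<subseteq> ?V' \<union> ?W"
    using extreme_point_of_convex_hull_insert_midpoint[OF S] VS by blast
  then have "card ?V \<le> card (?V' \<union> ?W)"
    using fin' S by (intro card_mono) auto
  also have "\<dots> \<le> card ?V' + card ?W" by (rule card_Un_le)
  finally have 2: "card ?V \<le> card ?V' + card ?W" .
  show ?thesis using 1 2 unfolding f0_def by linarith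
qed

section \<open>Caps, and the disk inside a hull that meets all of them\<close>

definition cap :: "real ^ 2 \<Rightarrow> real \<Rightarrow> (real ^ 2) set" where
  "cap u \<epsilon> = {y. norm y \<le> 1 \<and> 1 - \<epsilon> \<le> u \<bullet> y}"

lemma sets_cap [measurable]: "cap u \<epsilon> \<in> sets borel"
  unfolding cap_def by measurable

text \<open>A point \<open>y\<close> of the cap around \<open>w\<close> has distance at most
  \<open>sqrt (2 * \<epsilon>)\<close> from \<open>w\<close>, hence at most twice that from
  \<open>u\<close>. With \<open>(norm y)\<^sup>2 \<ge> 1 - 2 * \<epsilon>\<close>, the identity
  \<open>2 * (u \<bullet> y) = (norm y)\<^sup>2 + 1 - (norm (y - u))\<^sup>2\<close> loses at most
  \<open>2 * \<epsilon> + 8 * \<epsilon>\<close>, whence the factor 5.\<close>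

lemma cap_subset_cap:
  assumes u: "norm u = 1" and w: "norm w = 1" and uw: "(norm (u - w))\<^sup>2 \<le> 2 * \<epsilon>" and "\<epsilon> \<le> 1"
  shows "cap w \<epsilon> \<subseteq> cap u (5 * \<epsilon>)"
proof
  fix y assume "y \<in> cap w \<epsilon>"
  then have y: "norm y \<le> 1" "1 - \<epsilon> \<le> w \<bullet> y" by (auto simp: cap_def)
  have e: "0 \<le> \<epsilon>" using uw by (smt (verit) zero_le_power2)
  have yy: "(norm y)\<^sup>2 \<le> 1" using y by (simp add: power_le_one)
  have sq: "(norm (a - b))\<^sup>2 = (norm a)\<^sup>2 + (norm b)\<^sup>2 - 2 * (a \<bullet> b)" for a b :: "real ^ 2"
    by (simp add: power2_norm_eq_inner inner_diff inner_commute)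
  have yw: "(norm (y - w))\<^sup>2 \<le> 2 * \<epsilon>"
    using sq[of y w] yy y w by (simp add: inner_commute)
  have "norm (y - u) \<le> norm (y - w) + norm (w - u)"
    by (metis norm_triangle_ineq diff_add_cancel add_diff_eq)
  also have "\<dots> \<le> sqrt (2 * \<epsilon>) + sqrt (2 * \<epsilon>)"
    using yw uw by (intro add_mono real_le_rsqrt) (auto simp: norm_minus_commute)
  finally have "(norm (y - u))\<^sup>2 \<le> (2 * sqrt (2 * \<epsilon>))\<^sup>2"
    by (intro power_mono) auto
  then have yu: "(norm (y - u))\<^sup>2 \<le> 8 * \<epsilon>"
    using e by (simp add: power_mult_distrib)
  have "1 - \<epsilon> \<le> norm y"
    using y w norm_cauchy_schwarz[of w y] by simp
  then have "(1 - \<epsilon>)\<^sup>2 \<le> (norm y)\<^sup>2"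
    using \<open>\<epsilon> \<le> 1\<close> by (intro power_mono) auto
  then have "1 - 2 * \<epsilon> \<le> (norm y)\<^sup>2"
    using zero_le_power2[of \<epsilon>] unfolding power2_diff one_power2 by linarith
  then show "y \<in> cap u (5 * \<epsilon>)"
    using y yu sq[of y u] u by (simp add: cap_def inner_commute)
qed

text \<open>Round the angle of \<open>u\<close> down to a multiple of \<open>2 * pi / n\<close>. As
  cosine and sine are 1-Lipschitz, each coordinate moves by at most \<open>2 * pi / n\<close>, and
  the sum of the two bounds the norm.\<close>

lemma unit_vector_near_root:
  fixes u :: "real ^ 2"
  assumes "norm u = 1" "n > 0"
  obtains k where "k < n"
    "norm (u - vector [cos (2 * pi * real k / real n), sin (2 * pi * real k / real n)]) \<le> 4 * pi / real n"
proof -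
  have "(u $ 1)\<^sup>2 + (u $ 2)\<^sup>2 = 1"
    using assms by (simp add: norm_vec_def L2_set_def sum_2)
  then obtain t where t: "0 \<le> t" "t < 2 * pi" "u $ 1 = cos t" "u $ 2 = sin t"
    using sincos_total_2pi by metis
  define k where "k = nat \<lfloor>t * n / (2 * pi)\<rfloor>"
  have k: "real k \<le> t * n / (2 * pi)" "t * n / (2 * pi) < real k + 1"
    unfolding k_def using t by (auto simp: of_nat_nat floor_le_iff)
  have "t * n / (2 * pi) < n"
    using t assms by (simp add: field_simps)
  then have "k < n" using k by linarith
  define s where "s = 2 * pi * real k / real n"
  have ts: "\<bar>t - s\<bar> \<le> 2 * pi / n"
  proof -
    have "t - s = 2 * pi / n * (t * n / (2 * pi) - k)"
      using assms by (simp add: s_def field_simps)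
    moreover have "\<bar>t * n / (2 * pi) - k\<bar> \<le> 1" using k by linarith
    ultimately show ?thesis
      using mult_left_mono[of "\<bar>t * n / (2 * pi) - k\<bar>" 1 "2 * pi / n"] by (simp add: abs_mult)
  qed
  have dcos: "\<bar>cos t - cos s\<bar> \<le> \<bar>t - s\<bar>"
  proof -
    have "\<bar>cos t - cos s\<bar> = 2 * (\<bar>sin ((t + s) / 2)\<bar> * \<bar>sin ((s - t) / 2)\<bar>)"
      by (simp add: cos_diff_cos abs_mult)
    also have "\<dots> \<le> 2 * (1 * \<bar>(s - t) / 2\<bar>)"
      by (intro mult_left_mono mult_mono abs_sin_x_le_abs_x) auto
    finally show ?thesis by simp
  qed
  have dsin: "\<bar>sin t - sin s\<bar> \<le> \<bar>t - s\<bar>"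
  proof -
    have "\<bar>sin t - sin s\<bar> = 2 * (\<bar>sin ((t - s) / 2)\<bar> * \<bar>cos ((t + s) / 2)\<bar>)"
      by (simp add: sin_diff_sin abs_mult)
    also have "\<dots> \<le> 2 * (\<bar>(t - s) / 2\<bar> * 1)"
      by (intro mult_left_mono mult_mono abs_sin_x_le_abs_x) auto
    finally show ?thesis by simp
  qed
  have "norm (u - vector [cos s, sin s]) \<le> \<bar>cos t - cos s\<bar> + \<bar>sin t - sin s\<bar>"
    using norm_le_l1_cart[of "u - vector [cos s, sin s]"] t by (simp add: sum_2)
  also have "\<dots> \<le> 2 * pi / n + 2 * pi / n"
    using dcos dsin ts by (intro add_mono) auto
  also have "\<dots> = 4 * pi / n" by simp
  finally show ?thesis using that[OF \<open>k < n\<close>] by (simp add: s_def)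
qed

text \<open>A point \<open>z\<close> of the disk outside the hull is strictly separated from it, so
  in some unit direction \<open>u\<close> it lies further out than every point of \<open>S\<close>.
  A cap direction near \<open>u\<close> provides a point of \<open>S\<close> in
  \<open>cap u (5 * \<epsilon>)\<close>, whose \<open>u\<close>-coordinate is at least
  \<open>1 - 5 * \<epsilon> \<ge> norm z\<close>, a contradiction.\<close>

lemma cball_subset_convex_hull_if_caps_hit:
  fixes S :: "(real ^ 2) set"
  assumes S: "finite S" and n: "n > 0" and \<epsilon>: "\<epsilon> \<le> 1" "(4 * pi / real n)\<^sup>2 \<le> 2 * \<epsilon>"
    and hit: "\<And>k. k < n \<Longrightarrow>
      S \<inter> cap (vector [cos (2 * pi * real k / real n), sin (2 * pi * real k / real n)]) \<epsilon> \<noteq> {}"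
  shows "cball 0 (1 - 5 * \<epsilon>) \<subseteq> convex hull S"
proof (rule ccontr)
  assume "\<not> ?thesis"
  then obtain z where z: "norm z \<le> 1 - 5 * \<epsilon>" "z \<notin> convex hull S"
    by (meson mem_cball_0 subsetI)
  have "closed (convex hull S)"
    using S by (simp add: compact_imp_closed finite_imp_compact_convex_hull)
  with z obtain a b where ab: "a \<bullet> z < b" "\<And>y. y \<in> convex hull S \<Longrightarrow> b < a \<bullet> y"
    using separating_hyperplane_closed_point[of "convex hull S" z] by (auto simp: convex_convex_hull)
  have ne: "S \<noteq> {}" using hit n by blast
  then have "a \<noteq> 0" using ab hull_inc[of _ S convex] by fastforce
  define u where "u = - a /\<^sub>R norm a"
  have u: "norm u = 1" using \<open>a \<noteq> 0\<close> by (simp add: u_def)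
  obtain k where k: "k < n"
    "norm (u - vector [cos (2 * pi * real k / real n), sin (2 * pi * real k / real n)]) \<le> 4 * pi / real n"
    using unit_vector_near_root[OF u n] .
  let ?w = "vector [cos (2 * pi * real k / real n), sin (2 * pi * real k / real n)] :: real ^ 2"
  obtain y where y: "y \<in> S" "y \<in> cap ?w \<epsilon>" using hit[OF k(1)] by auto
  have "norm ?w = 1" by (simp add: norm_vec_def L2_set_def sum_2)
  moreover have "(norm (u - ?w))\<^sup>2 \<le> 2 * \<epsilon>"
    using power_mono[OF k(2), of 2] \<epsilon>(2) by (meson norm_ge_zero order_trans)
  ultimately have "y \<in> cap u (5 * \<epsilon>)"
    using cap_subset_cap[OF u] y \<epsilon> by blast
  then have uy: "1 - 5 * \<epsilon> \<le> u \<bullet> y" by (simp add: cap_def)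
  have "a \<bullet> z < a \<bullet> y" using ab y hull_inc[of y S convex] by force
  then have "u \<bullet> y < u \<bullet> z" using \<open>a \<noteq> 0\<close> by (simp add: u_def)
  also have "\<dots> \<le> norm z" using norm_cauchy_schwarz[of u z] u by simp
  finally show False using uy z by simp
qed

section \<open>Beta measure of caps and annuli\<close>

lemma sets_beta_law [simp, measurable_cong]: "sets (beta_law \<beta>) = sets borel"
  by (simp add: beta_law_def)

lemma space_beta_law [simp]: "space (beta_law \<beta>) = UNIV"
  by (simp add: beta_law_def)

lemma borel_measurable_beta_density [measurable]:
  "(\<lambda>x :: real ^ 2. ennreal (indicator (cball 0 1) x * ((\<beta> + 1) / pi * (1 - (norm x)\<^sup>2) powr \<beta>)))
    \<in> borel_measurable borel"
proof -
  have [measurable]: "cball (0 :: real ^ 2) 1 \<in> sets borel" by simp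
  show ?thesis by measurable
qed

lemma emeasure_beta_law:
  assumes A: "A \<in> sets borel"
  shows "emeasure (beta_law \<beta>) A = (\<integral>\<^sup>+ x. ennreal (indicator (cball 0 1) x *
    ((\<beta> + 1) / pi * (1 - (norm x)\<^sup>2) powr \<beta>)) * indicator A x \<partial>lborel)"
  unfolding beta_law_def using A borel_measurable_beta_density by (intro emeasure_density) simp_all

text \<open>For \<open>0 \<le> \<beta>\<close> the density is monotone in
  \<open>1 - (norm y)\<^sup>2\<close> on the disk, so a bound on this quantity reduces beta measure
  to area.\<close>

lemma emeasure_beta_law_le:
  assumes \<beta>: "0 \<le> \<beta>" and A: "A \<in> sets borel"
    and s: "\<And>y. y \<in> A \<Longrightarrow> norm y \<le> 1 \<Longrightarrow> 1 - (norm y)\<^sup>2 \<le> s"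
  shows "emeasure (beta_law \<beta>) A
    \<le> ennreal ((\<beta> + 1) / pi * s powr \<beta>) * emeasure lborel (A \<inter> cball 0 1)"
proof -
  let ?C = "ennreal ((\<beta> + 1) / pi * s powr \<beta>)"
  have "emeasure (beta_law \<beta>) A \<le> (\<integral>\<^sup>+ x. ?C * indicator (A \<inter> cball 0 1) x \<partial>lborel)"
    unfolding emeasure_beta_law[OF A]
  proof (intro nn_integral_mono)
    fix x :: "real ^ 2"
    show "ennreal (indicator (cball 0 1) x * ((\<beta> + 1) / pi * (1 - (norm x)\<^sup>2) powr \<beta>)) * indicator A x
      \<le> ?C * indicator (A \<inter> cball 0 1) x"
    proof (cases "x \<in> A \<inter> cball 0 1")
      case True
      then have "0 \<le> 1 - (norm x)\<^sup>2" by (simp add: power_le_one)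
      then have "(1 - (norm x)\<^sup>2) powr \<beta> \<le> s powr \<beta>"
        using True s[of x] \<beta> by (intro powr_mono2) auto
      then show ?thesis
        using True \<beta> by (auto intro!: ennreal_leI divide_right_mono mult_left_mono)
    qed (auto split: split_indicator)
  qed
  also have "\<dots> = ?C * emeasure lborel (A \<inter> cball 0 1)"
    using A by (intro nn_integral_cmult_indicator) auto
  finally show ?thesis .
qed

text \<open>The same comparison from below; \<open>0 \<le> s\<close> forces \<open>A\<close> into
  the unit disk, so its full area counts.\<close>

lemma emeasure_beta_law_ge:
  assumes \<beta>: "0 \<le> \<beta>" and A: "A \<in> sets borel"
    and s: "0 \<le> s" "\<And>y. y \<in> A \<Longrightarrow> s \<le> 1 - (norm y)\<^sup>2"
  shows "ennreal ((\<beta> + 1) / pi * s powr \<beta>) * emeasure lborel A \<le> emeasure (beta_law \<beta>) A"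
proof -
  let ?C = "ennreal ((\<beta> + 1) / pi * s powr \<beta>)"
  have "?C * emeasure lborel A = (\<integral>\<^sup>+ x. ?C * indicator A x \<partial>lborel)"
    using A by (intro nn_integral_cmult_indicator[symmetric]) auto
  also have "\<dots> \<le> emeasure (beta_law \<beta>) A"
    unfolding emeasure_beta_law[OF A]
  proof (intro nn_integral_mono)
    fix x :: "real ^ 2"
    show "?C * indicator A x
      \<le> ennreal (indicator (cball 0 1) x * ((\<beta> + 1) / pi * (1 - (norm x)\<^sup>2) powr \<beta>)) * indicator A x"
    proof (cases "x \<in> A")
      case True
      then have "(norm x)\<^sup>2 \<le> 1" using s(1) s(2)[of x] by simp
      then have "norm x \<le> 1" by (simp add: power_le_one_iff)
      moreover have "s powr \<beta> \<le> (1 - (norm x)\<^sup>2) powr \<beta>"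
        using True s \<beta> by (intro powr_mono2) auto
      ultimately show ?thesis
        using True \<beta> by (auto intro!: ennreal_leI divide_right_mono mult_left_mono)
    qed simp
  qed
  finally show ?thesis .
qed

text \<open>On the cap \<open>(u \<bullet> y)\<^sup>2 \<ge> (1 - \<eta>)\<^sup>2 \<ge> 1 - 2 *
  \<eta>\<close>. Together with \<open>norm y \<le> 1\<close> this confines the cap to a rectangle
  of height \<open>\<eta>\<close> and half-width \<open>sqrt (2 * \<eta>)\<close>, and it also
  bounds \<open>1 - (norm y)\<^sup>2\<close> by \<open>2 * \<eta>\<close>. The resulting order is
  \<open>\<eta> powr (\<beta> + 3 / 2)\<close>.\<close>

lemma emeasure_cap_le:
  assumes \<beta>: "0 \<le> \<beta>" and u: "norm u = 1" and \<eta>: "0 \<le> \<eta>" "\<eta> \<le> 1"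
  shows "emeasure (beta_law \<beta>) (cap u \<eta>)
    \<le> ennreal ((\<beta> + 1) / pi * (2 * \<eta>) powr \<beta> * (\<eta> * (2 * sqrt (2 * \<eta>))))"
proof -
  have y: "1 - 2 * \<eta> \<le> (u \<bullet> y)\<^sup>2" "u \<bullet> y \<le> 1" if "y \<in> cap u \<eta>" for y
  proof -
    show "u \<bullet> y \<le> 1"
      using that norm_cauchy_schwarz[of u y] u by (simp add: cap_def)
    have *: "(1 - \<eta>)\<^sup>2 \<le> (u \<bullet> y)\<^sup>2"
      using that \<eta> by (intro power_mono) (auto simp: cap_def)
    have "1 - 2 * \<eta> \<le> (1 - \<eta>)\<^sup>2"
      using zero_le_power2[of \<eta>] unfolding power2_diff one_power2 by linarith
    with * show "1 - 2 * \<eta> \<le> (u \<bullet> y)\<^sup>2" by simp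
  qed
  let ?R = "{y. 1 - \<eta> \<le> u \<bullet> y \<and> u \<bullet> y \<le> 1 \<and> - sqrt (2 * \<eta>) \<le> perp u \<bullet> y \<and> perp u \<bullet> y \<le> sqrt (2 * \<eta>)}"
  have "cap u \<eta> \<subseteq> ?R"
  proof
    fix z assume z: "z \<in> cap u \<eta>"
    then have "(norm z)\<^sup>2 \<le> 1" by (simp add: cap_def power_le_one)
    then have "(perp u \<bullet> z)\<^sup>2 \<le> 2 * \<eta>"
      using inner_perp_square_sum[OF u, of z] y(1)[OF z] by linarith
    then have "\<bar>perp u \<bullet> z\<bar> \<le> sqrt (2 * \<eta>)"
      by (intro real_le_rsqrt) simp
    then show "z \<in> ?R" using z y(2)[OF z] by (auto simp: cap_def abs_le_iff)
  qed
  then have "cap u \<eta> \<inter> cball 0 1 \<subseteq> ?R" by blast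
  then have "emeasure lborel (cap u \<eta> \<inter> cball 0 1) \<le> emeasure lborel ?R"
    by (intro emeasure_mono) auto
  also have "\<dots> = ennreal (\<eta> * (2 * sqrt (2 * \<eta>)))"
    using emeasure_lborel_rotated_rectangle[OF u, of "1 - \<eta>" 1 "- sqrt (2 * \<eta>)" "sqrt (2 * \<eta>)"] \<eta>
    by simp
  finally have R: "emeasure lborel (cap u \<eta> \<inter> cball 0 1) \<le> ennreal (\<eta> * (2 * sqrt (2 * \<eta>)))" .
  have "emeasure (beta_law \<beta>) (cap u \<eta>)
      \<le> ennreal ((\<beta> + 1) / pi * (2 * \<eta>) powr \<beta>) * emeasure lborel (cap u \<eta> \<inter> cball 0 1)"
  proof (rule emeasure_beta_law_le[OF \<beta>])
    fix z assume z: "z \<in> cap u \<eta>"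
    show "1 - (norm z)\<^sup>2 \<le> 2 * \<eta>"
      using inner_perp_square_sum[OF u, of z] y(1)[OF z] zero_le_power2[of "perp u \<bullet> z"] by linarith
  qed simp
  also have "\<dots> \<le> ennreal ((\<beta> + 1) / pi * (2 * \<eta>) powr \<beta>) * ennreal (\<eta> * (2 * sqrt (2 * \<eta>)))"
    by (intro mult_left_mono R) simp
  finally show ?thesis
    using \<beta> \<eta> by (subst ennreal_mult) auto
qed

text \<open>The inscribed rectangle stops at height \<open>1 - \<epsilon> / 2\<close> to stay away
  from the circle, where the density may vanish. There
  \<open>(u \<bullet> z)\<^sup>2 \<le> 1 - 3 * \<epsilon> / 4\<close> and
  \<open>(perp u \<bullet> z)\<^sup>2 \<le> \<epsilon> / 4\<close>, so
  \<open>1 - (norm z)\<^sup>2\<close> is still at least \<open>\<epsilon> / 2\<close>.\<close>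

lemma emeasure_cap_ge:
  assumes \<beta>: "0 \<le> \<beta>" and u: "norm u = 1" and \<epsilon>: "0 < \<epsilon>" "\<epsilon> \<le> 1"
  shows "ennreal ((\<beta> + 1) / pi * (\<epsilon> / 2) powr \<beta> * (\<epsilon> / 2 * sqrt \<epsilon>))
    \<le> emeasure (beta_law \<beta>) (cap u \<epsilon>)"
proof -
  let ?s = "sqrt \<epsilon> / 2"
  let ?R = "{y. 1 - \<epsilon> \<le> u \<bullet> y \<and> u \<bullet> y \<le> 1 - \<epsilon> / 2 \<and> - ?s \<le> perp u \<bullet> y \<and> perp u \<bullet> y \<le> ?s}"
  have nz: "\<epsilon> / 2 \<le> 1 - (norm z)\<^sup>2" if z: "z \<in> ?R" for z
  proof -
    have "(u \<bullet> z)\<^sup>2 \<le> (1 - \<epsilon> / 2)\<^sup>2"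
      using z \<epsilon> by (intro power_mono) auto
    also have "\<dots> = 1 - \<epsilon> + \<epsilon> * \<epsilon> / 4"
      by (simp add: power2_eq_square field_simps)
    also have "\<dots> \<le> 1 - \<epsilon> + \<epsilon> / 4"
      using \<epsilon> mult_left_le[of \<epsilon> \<epsilon>] by linarith
    finally have 1: "(u \<bullet> z)\<^sup>2 \<le> 1 - \<epsilon> + \<epsilon> / 4" .
    have "\<bar>perp u \<bullet> z\<bar> \<le> ?s" using z unfolding mem_Collect_eq abs_le_iff by linarith
    then have "\<bar>perp u \<bullet> z\<bar>\<^sup>2 \<le> ?s\<^sup>2" by (intro power_mono) auto
    then have "(perp u \<bullet> z)\<^sup>2 \<le> \<epsilon> / 4" using \<epsilon> by (simp add: power_divide)
    then show ?thesis
      using inner_perp_square_sum[OF u, of z] 1 by linarith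
  qed
  have sub: "?R \<subseteq> cap u \<epsilon>"
  proof
    fix z assume z: "z \<in> ?R"
    have "(norm z)\<^sup>2 \<le> 1" using nz[OF z] \<epsilon> by linarith
    then have "norm z \<le> 1" by (simp add: power_le_one_iff)
    then show "z \<in> cap u \<epsilon>" using z by (auto simp: cap_def)
  qed
  have "ennreal ((\<beta> + 1) / pi * (\<epsilon> / 2) powr \<beta> * (\<epsilon> / 2 * sqrt \<epsilon>))
    = ennreal ((\<beta> + 1) / pi * (\<epsilon> / 2) powr \<beta>) * emeasure lborel ?R"
    using emeasure_lborel_rotated_rectangle[OF u, of "1 - \<epsilon>" "1 - \<epsilon> / 2" "- ?s" ?s] \<epsilon> \<beta>
    by (simp add: ennreal_mult[symmetric])
  also have "\<dots> \<le> emeasure (beta_law \<beta>) ?R"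
    using \<epsilon> nz by (intro emeasure_beta_law_ge[OF \<beta>]) auto
  also have "\<dots> \<le> emeasure (beta_law \<beta>) (cap u \<epsilon>)"
    using sub by (intro emeasure_mono) auto
  finally show ?thesis .
qed

lemma emeasure_annulus_le:
  assumes \<beta>: "0 \<le> \<beta>" and h: "0 \<le> h" "h \<le> 1"
  shows "emeasure (beta_law \<beta>) {y. 1 - h < norm y \<and> norm y \<le> 1}
    \<le> ennreal ((\<beta> + 1) / pi * (2 * h) powr \<beta> * (2 * pi * h))"
proof -
  let ?A = "{y :: real ^ 2. 1 - h < norm y \<and> norm y \<le> 1}"
  have hh: "1 - 2 * h \<le> (1 - h)\<^sup>2"
    using zero_le_power2[of h] unfolding power2_diff one_power2 by linarith
  have "?A \<inter> cball 0 1 = cball 0 1 - cball 0 (1 - h)" by auto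
  then have "emeasure lborel (?A \<inter> cball 0 1)
      = emeasure lborel (cball (0 :: real ^ 2) 1) - emeasure lborel (cball (0 :: real ^ 2) (1 - h))"
    using h by (simp add: emeasure_Diff emeasure_cball subset_cball)
  also have "\<dots> = ennreal (pi - pi * (1 - h)\<^sup>2)"
    using h by (simp add: emeasure_cball unit_ball_vol_2 ennreal_minus)
  also have "\<dots> \<le> ennreal (2 * pi * h)"
  proof (rule ennreal_leI)
    have "pi * (1 - 2 * h) \<le> pi * (1 - h)\<^sup>2" using hh by (intro mult_left_mono) auto
    then show "pi - pi * (1 - h)\<^sup>2 \<le> 2 * pi * h" by (simp add: algebra_simps)
  qed
  finally have A: "emeasure lborel (?A \<inter> cball 0 1) \<le> ennreal (2 * pi * h)" .
  have "emeasure (beta_law \<beta>) ?A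
      \<le> ennreal ((\<beta> + 1) / pi * (2 * h) powr \<beta>) * emeasure lborel (?A \<inter> cball 0 1)"
  proof (rule emeasure_beta_law_le[OF \<beta>])
    fix z assume "z \<in> ?A"
    then have "(1 - h)\<^sup>2 \<le> (norm z)\<^sup>2" using h by (intro power_mono) auto
    then show "1 - (norm z)\<^sup>2 \<le> 2 * h" using hh by linarith
  qed measurable
  also have "\<dots> \<le> ennreal ((\<beta> + 1) / pi * (2 * h) powr \<beta>) * ennreal (2 * pi * h)"
    by (intro mult_left_mono A) simp
  finally show ?thesis
    using \<beta> h by (subst ennreal_mult) auto
qed

lemma AE_beta_law: "AE y in beta_law \<beta>. norm y \<le> 1"
  unfolding beta_law_def using borel_measurable_beta_density
  by (subst AE_density) (auto split: split_indicator)

section \<open>Pointwise bounds on the first order difference\<close>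

lemma near_pairs_subset_cap:
  fixes x :: "real ^ 2"
  assumes \<epsilon>: "0 < \<epsilon>" "\<epsilon> \<le> 1 / 20" and x: "1 - 5 * \<epsilon> < norm x" "norm x \<le> 1"
  shows "{y. norm y \<le> 1 \<and> 2 * (1 - 5 * \<epsilon>) \<le> norm (x + y)} \<subseteq> cap (x /\<^sub>R norm x) (20 * \<epsilon>)"
proof
  fix y assume y: "y \<in> {y. norm y \<le> 1 \<and> 2 * (1 - 5 * \<epsilon>) \<le> norm (x + y)}"
  have x0: "0 < norm x" using x \<epsilon> by linarith
  \<comment> \<open>Expanding the square with both norms at most 1 yields \<open>x \<bullet> y \<ge>
    2 * (1 - 5 * \<epsilon>)\<^sup>2 - 1 \<ge> 1 - 20 * \<epsilon>\<close>. This is nonnegative as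
    \<open>\<epsilon> \<le> 1 / 20\<close>, so normalizing \<open>x\<close> can only increase the
    inner product.\<close>
  have "(2 * (1 - 5 * \<epsilon>))\<^sup>2 \<le> (norm (x + y))\<^sup>2"
    using y \<epsilon> by (intro power_mono) auto
  also have "\<dots> = (norm x)\<^sup>2 + (norm y)\<^sup>2 + 2 * (x \<bullet> y)"
    by (simp add: power2_norm_eq_inner inner_add inner_commute)
  also have "\<dots> \<le> 1 + 1 + 2 * (x \<bullet> y)"
    using x y by (intro add_mono) (auto simp: power_le_one)
  finally have "2 * (1 - 5 * \<epsilon>)\<^sup>2 - 1 \<le> x \<bullet> y"
    unfolding power_mult_distrib by simp
  moreover have "1 - 10 * \<epsilon> \<le> (1 - 5 * \<epsilon>)\<^sup>2"
    using zero_le_power2[of "5 * \<epsilon>"] unfolding power2_diff one_power2 by linarith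
  ultimately have xy: "1 - 20 * \<epsilon> \<le> x \<bullet> y" by linarith
  have "0 \<le> x \<bullet> y" using xy \<epsilon> by linarith
  then have "x \<bullet> y \<le> (x \<bullet> y) / norm x"
    using x x0 by (simp add: le_divide_eq mult_left_le)
  then show "y \<in> cap (x /\<^sub>R norm x) (20 * \<epsilon>)"
    using y xy by (simp add: cap_def divide_inverse mult.commute)
qed

lemma Df0_le:
  assumes "n \<ge> 1"
  shows "\<bar>Df0 n x\<bar> \<le> real n"
proof -
  have "f0 (convex hull (x ` {1..n})) \<le> n"
    using f0_convex_hull_le[of "x ` {1..n}"] card_image_le[of "{1..n}" x] by simp
  moreover have "f0 (convex hull (x ` {2..n})) \<le> n"
    using f0_convex_hull_le[of "x ` {2..n}"] card_image_le[of "{2..n}" x] by simp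
  ultimately show ?thesis
    unfolding Df0_def by linarith
qed

text \<open>If \<open>x 1\<close> is in the disk, the hull does not change. Otherwise a lost vertex
  \<open>x j\<close> has its midpoint with \<open>x 1\<close> outside the disk. Counting indices
  instead of points makes the count a sum of indicators, independent once the first point is
  fixed.\<close>

lemma Df0_le_near_pairs:
  assumes n: "n \<ge> 1" and norm: "\<And>i. i \<in> {1..n} \<Longrightarrow> norm (x i) \<le> 1"
    and r: "cball 0 r \<subseteq> convex hull (x ` {2..n})"
  shows "\<bar>Df0 n x\<bar> \<le> (if norm (x 1) \<le> r then 0
    else 1 + real (card {j \<in> {2..n}. norm (x j) \<le> 1 \<and> 2 * r \<le> norm (x 1 + x j)}))"
proof -
  have "{1..n} = insert 1 {2..n}" using n by auto
  then have img: "x ` {1..n} = insert (x 1) (x ` {2..n})" by (metis image_insert)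
  show ?thesis
  proof (cases "norm (x 1) \<le> r")
    case True
    then have "x 1 \<in> convex hull (x ` {2..n})" using r by auto
    then show ?thesis using True unfolding Df0_def img by (simp add: hull_redundant)
  next
    case False
    let ?J = "{j \<in> {2..n}. norm (x j) \<le> 1 \<and> 2 * r \<le> norm (x 1 + x j)}"
    have "{v \<in> x ` {2..n}. midpoint (x 1) v \<notin> convex hull (x ` {2..n})} \<subseteq> x ` ?J"
    proof safe
      fix j assume j: "j \<in> {2..n}" "midpoint (x 1) (x j) \<notin> convex hull (x ` {2..n})"
      then have "midpoint (x 1) (x j) \<notin> cball 0 r" using r by auto
      then have "2 * r \<le> norm (x 1 + x j)" by (simp add: midpoint_def)
      then show "x j \<in> x ` ?J" using j norm[of j] by auto
    qed
    then have "card {v \<in> x ` {2..n}. midpoint (x 1) v \<notin> convex hull (x ` {2..n})} \<le> card (x ` ?J)"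
      by (intro card_mono) auto
    also have "\<dots> \<le> card ?J" by (intro card_image_le) auto
    finally show ?thesis
      using False f0_convex_hull_insert_diff[of "x ` {2..n}" "x 1"] unfolding Df0_def img by simp
  qed
qed

section \<open>Integration over the independent sample\<close>

lemma random_sampleD:
  assumes "random_sample \<mu> n M X"
  shows "prob_space M" "prob_space.indep_vars M (\<lambda>_. borel) X {1..n}"
    "\<And>i. i \<in> {1..n} \<Longrightarrow> X i \<in> borel_measurable M"
    "\<And>i. i \<in> {1..n} \<Longrightarrow> distr M borel (X i) = \<mu>"
proof -
  show M: "prob_space M" and I: "prob_space.indep_vars M (\<lambda>_. borel) X {1..n}"
    and "\<And>i. i \<in> {1..n} \<Longrightarrow> distr M borel (X i) = \<mu>"
    using assms by (auto simp: random_sample_def)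
  show "\<And>i. i \<in> {1..n} \<Longrightarrow> X i \<in> borel_measurable M"
    using I unfolding prob_space.indep_vars_def[OF M] by blast
qed

lemma random_sample_prob_space:
  assumes "random_sample \<mu> n M X" "n \<ge> 1"
  shows "prob_space \<mu>"
proof -
  have "1 \<in> {1..n}" using assms by simp
  then show ?thesis
    using random_sampleD[OF assms(1)] prob_space.prob_space_distr by metis
qed

text \<open>By independence the joint law is the product measure. Conditioning on the first point
  leaves \<open>n - 1\<close> coordinates, over which the product integrates factor by
  factor.\<close>

lemma nn_integral_random_sample_prod:
  fixes f :: "real ^ 2 \<Rightarrow> real ^ 2 \<Rightarrow> ennreal"
  assumes S: "random_sample \<mu> n M X" and n: "n \<ge> 1"
    and g [measurable]: "g \<in> borel_measurable borel"
    and f [measurable]: "case_prod f \<in> borel_measurable (borel \<Otimes>\<^sub>M borel)"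
  shows "(\<integral>\<^sup>+ \<omega>. g (X 1 \<omega>) * (\<Prod>j\<in>{2..n}. f (X 1 \<omega>) (X j \<omega>)) \<partial>M)
    = (\<integral>\<^sup>+ x. g x * (\<integral>\<^sup>+ y. f x y \<partial>\<mu>) ^ (n - 1) \<partial>\<mu>)"
proof -
  note D = random_sampleD[OF S]
  interpret M: prob_space M by (rule D)
  interpret \<mu>: prob_space \<mu> by (rule random_sample_prob_space[OF S n])
  interpret P: product_sigma_finite "\<lambda>_ :: nat. \<mu>" by standard
  have "1 \<in> {1..n}" using n by simp
  then have sets: "sets \<mu> = sets borel" using D(4)[of 1] by (metis sets_distr)
  note [measurable_cong] = sets
  define F where "F z = g (z 1) * (\<Prod>j\<in>{2..n}. f (z 1) (z j))" for z
  have one: "insert 1 {2..n} = {1..n}" using n by auto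
  have Fb: "F \<in> borel_measurable (Pi\<^sub>M {1..n} (\<lambda>_. borel))"
  proof -
    have [measurable]: "(\<lambda>z. z 1) \<in> borel_measurable (Pi\<^sub>M {1..n} (\<lambda>_. borel))"
      using n by (intro measurable_component_singleton) auto
    have "(\<lambda>z. f (z 1) (z j)) \<in> borel_measurable (Pi\<^sub>M {1..n} (\<lambda>_. borel))" if "j \<in> {2..n}" for j
    proof -
      have [measurable]: "(\<lambda>z. z j) \<in> borel_measurable (Pi\<^sub>M {1..n} (\<lambda>_. borel))"
        using that by (intro measurable_component_singleton) auto
      show ?thesis by measurable
    qed
    moreover have "(\<lambda>z. g (z 1)) \<in> borel_measurable (Pi\<^sub>M {1..n} (\<lambda>_. borel))"
      by measurable
    ultimately show ?thesis
      unfolding F_def by (intro borel_measurable_times_ennreal borel_measurable_prod_ennreal)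
  qed
  have F: "F \<in> borel_measurable (Pi\<^sub>M {1..n} (\<lambda>_. \<mu>))"
    using Fb by (subst measurable_cong_sets[OF sets_PiM_cong[OF refl sets] refl]) 
  have X: "(\<lambda>\<omega>. \<lambda>i\<in>{1..n}. X i \<omega>) \<in> measurable M (Pi\<^sub>M {1..n} (\<lambda>_. borel))"
    using D(3) by (intro measurable_restrict) auto
  have "distr M (Pi\<^sub>M {1..n} (\<lambda>_. borel)) (\<lambda>\<omega>. \<lambda>i\<in>{1..n}. X i \<omega>)
      = Pi\<^sub>M {1..n} (\<lambda>i. distr M borel (X i))"
    using D(2) M.indep_vars_iff_distr_eq_PiM'[where I = "{1..n}" and M' = "\<lambda>_. borel" and X = X] D(3) n by auto
  also have "\<dots> = Pi\<^sub>M {1..n} (\<lambda>_. \<mu>)"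
    using D(4) by (intro PiM_cong) auto
  finally have distr: "distr M (Pi\<^sub>M {1..n} (\<lambda>_. borel)) (\<lambda>\<omega>. \<lambda>i\<in>{1..n}. X i \<omega>)
      = Pi\<^sub>M {1..n} (\<lambda>_. \<mu>)" .
  have "(\<integral>\<^sup>+ \<omega>. g (X 1 \<omega>) * (\<Prod>j\<in>{2..n}. f (X 1 \<omega>) (X j \<omega>)) \<partial>M)
      = (\<integral>\<^sup>+ \<omega>. F (\<lambda>i\<in>{1..n}. X i \<omega>) \<partial>M)"
    using n by (intro nn_integral_cong) (auto simp: F_def intro!: prod.cong)
  also have "\<dots> = integral\<^sup>N (Pi\<^sub>M {1..n} (\<lambda>_. \<mu>)) F"
    unfolding distr[symmetric] using Fb by (intro nn_integral_distr[OF X, symmetric]) simp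
  also have "\<dots> = (\<integral>\<^sup>+ x. (\<integral>\<^sup>+ z. F (z(1 := x)) \<partial>Pi\<^sub>M {2..n} (\<lambda>_. \<mu>)) \<partial>\<mu>)"
    using P.product_nn_integral_insert_rev[of "{2..n}" 1 F] F unfolding one by simp
  also have "\<dots> = (\<integral>\<^sup>+ x. g x * (\<integral>\<^sup>+ y. f x y \<partial>\<mu>) ^ (n - 1) \<partial>\<mu>)"
  proof (intro nn_integral_cong)
    fix x
    have fx [measurable]: "f x \<in> borel_measurable \<mu>" by measurable
    have "(\<integral>\<^sup>+ z. F (z(1 := x)) \<partial>Pi\<^sub>M {2..n} (\<lambda>_. \<mu>))
        = (\<integral>\<^sup>+ z. g x * (\<Prod>j\<in>{2..n}. f x (z j)) \<partial>Pi\<^sub>M {2..n} (\<lambda>_. \<mu>))"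
      by (intro nn_integral_cong) (auto simp: F_def intro!: prod.cong)
    also have "\<dots> = g x * (\<integral>\<^sup>+ z. (\<Prod>j\<in>{2..n}. f x (z j)) \<partial>Pi\<^sub>M {2..n} (\<lambda>_. \<mu>))"
      by (intro nn_integral_cmult) measurable
    also have "(\<integral>\<^sup>+ z. (\<Prod>j\<in>{2..n}. f x (z j)) \<partial>Pi\<^sub>M {2..n} (\<lambda>_. \<mu>)) = (\<integral>\<^sup>+ y. f x y \<partial>\<mu>) ^ (n - 1)"
      by (subst P.product_nn_integral_prod) auto
    finally show "(\<integral>\<^sup>+ z. F (z(1 := x)) \<partial>Pi\<^sub>M {2..n} (\<lambda>_. \<mu>)) = g x * (\<integral>\<^sup>+ y. f x y \<partial>\<mu>) ^ (n - 1)" .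
  qed
  finally show ?thesis .
qed

text \<open>The preceding product formula with \<open>g = 1\<close> and \<open>f\<close> the
  indicator of the complement of \<open>T\<close>.\<close>

lemma emeasure_random_sample_avoids:
  assumes S: "random_sample \<mu> n M X" and n: "n \<ge> 1" and T [measurable]: "T \<in> sets borel"
    and \<tau>: "0 \<le> \<tau>" "ennreal \<tau> \<le> emeasure \<mu> T"
  shows "emeasure M {\<omega> \<in> space M. \<forall>j\<in>{2..n}. X j \<omega> \<notin> T} \<le> ennreal ((1 - \<tau>) ^ (n - 1))"
proof -
  note D = random_sampleD[OF S]
  interpret M: prob_space M by (rule D)
  interpret \<mu>: prob_space \<mu> by (rule random_sample_prob_space[OF S n])
  have "1 \<in> {1..n}" using n by simp
  then have sets [measurable_cong]: "sets \<mu> = sets borel" using D(4)[of 1] by (metis sets_distr)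
  then have space: "space \<mu> = UNIV" using sets_eq_imp_space_eq by fastforce
  have [measurable]: "X j \<in> borel_measurable M" if "j \<in> {2..n}" for j using D(3)[of j] that by auto
  have [measurable]: "{\<omega> \<in> space M. \<forall>j\<in>{2..n}. X j \<omega> \<notin> T} \<in> sets M"
    by measurable
  have "emeasure M {\<omega> \<in> space M. \<forall>j\<in>{2..n}. X j \<omega> \<notin> T}
      = (\<integral>\<^sup>+ \<omega>. indicator {\<omega> \<in> space M. \<forall>j\<in>{2..n}. X j \<omega> \<notin> T} \<omega> \<partial>M)"
    by simp
  also have "\<dots> = (\<integral>\<^sup>+ \<omega>. 1 * (\<Prod>j\<in>{2..n}. indicator (- T) (X j \<omega>)) \<partial>M)"
    by (intro nn_integral_cong) (auto split: split_indicator)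
  also have "\<dots> = (\<integral>\<^sup>+ x. 1 * (\<integral>\<^sup>+ y. indicator (- T) y \<partial>\<mu>) ^ (n - 1) \<partial>\<mu>)"
    by (rule nn_integral_random_sample_prod[OF S n]) measurable
  also have "\<dots> = emeasure \<mu> (- T) ^ (n - 1)"
    by (simp add: \<mu>.emeasure_space_1 sets)
  also have "emeasure \<mu> (- T) \<le> ennreal (1 - \<tau>)"
  proof -
    have "\<tau> \<le> measure \<mu> T" using \<tau> by (simp add: \<mu>.emeasure_eq_measure)
    moreover have "measure \<mu> (- T) = 1 - measure \<mu> T"
      using \<mu>.prob_compl[of T] by (simp add: space sets Compl_eq_Diff_UNIV)
    ultimately show ?thesis by (auto simp: \<mu>.emeasure_eq_measure intro!: ennreal_leI)
  qed
  also have "ennreal (1 - \<tau>) ^ (n - 1) = ennreal ((1 - \<tau>) ^ (n - 1))"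
  proof (rule ennreal_power)
    have "ennreal \<tau> \<le> 1" using \<tau> \<mu>.emeasure_le_1 order_trans by blast
    then show "0 \<le> 1 - \<tau>" using \<tau> by simp
  qed
  finally show ?thesis by (simp add: power_mono)
qed

section \<open>Moment bound with free parameters\<close>

lemma power_le_fact_exp:
  fixes x :: real
  assumes "0 \<le> x"
  shows "x ^ p \<le> fact p * exp x"
proof -
  have s: "(\<lambda>n. x ^ n /\<^sub>R fact n) sums exp x" by (rule exp_converges)
  have "x ^ p /\<^sub>R fact p = (\<Sum>i\<in>{p}. x ^ i /\<^sub>R fact i)" by simp
  also have "\<dots> \<le> (\<Sum>i. x ^ i /\<^sub>R fact i)"
    using s assms by (intro sum_le_suminf) (auto simp: sums_iff)
  also have "\<dots> = exp x" using s by (simp add: sums_iff)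
  finally show ?thesis by (simp add: field_simps)
qed

text \<open>Here \<open>\<tau>\<close> bounds a cap of height \<open>\<epsilon>\<close> from below,
  while \<open>\<sigma>\<close> and \<open>\<alpha>\<close> bound a cap of height
  \<open>20 * \<epsilon>\<close> and the annulus of width \<open>5 * \<epsilon>\<close> from above.
  The first summand is the trivial bound \<open>n ^ p\<close> times a union bound over
  \<open>n\<close> missed caps. The second is the exponential moment at \<open>1 / L\<close> of the
  number of points near \<open>X 1\<close>, restricted to \<open>X 1\<close> in the annulus.\<close>

lemma expectation_Df0_le:
  assumes S: "random_sample (beta_law \<beta>) n M X" and n: "n \<ge> 1" and \<beta>: "0 \<le> \<beta>"
    and \<epsilon>: "0 < \<epsilon>" "\<epsilon> \<le> 1 / 20" "(4 * pi / real n)\<^sup>2 \<le> 2 * \<epsilon>" and L: "0 < L" and p: "p \<ge> 1"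
  defines "\<tau> \<equiv> (\<beta> + 1) / pi * (\<epsilon> / 2) powr \<beta> * (\<epsilon> / 2 * sqrt \<epsilon>)"
    and "\<sigma> \<equiv> (\<beta> + 1) / pi * (2 * (20 * \<epsilon>)) powr \<beta> * (20 * \<epsilon> * (2 * sqrt (2 * (20 * \<epsilon>))))"
    and "\<alpha> \<equiv> (\<beta> + 1) / pi * (2 * (5 * \<epsilon>)) powr \<beta> * (2 * pi * (5 * \<epsilon>))"
  shows "prob_space.expectation M (\<lambda>\<omega>. \<bar>Df0 n (\<lambda>i. X i \<omega>)\<bar> ^ p)
    \<le> real n ^ p * (real n * (1 - \<tau>) ^ (n - 1))
      + fact p * L ^ p * exp (1 / L) * (\<alpha> * (1 + (exp (1 / L) - 1) * \<sigma>) ^ (n - 1))"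
    (is "_ \<le> ?bad + ?good")
proof -
  note D = random_sampleD[OF S]
  interpret M: prob_space M by (rule D)
  interpret \<mu>: prob_space "beta_law \<beta>" by (rule random_sample_prob_space[OF S n])
  have mX [measurable]: "X j \<in> borel_measurable M" if "j \<in> {1..n}" for j using D(3)[of j] that by auto
  have mX2 [measurable]: "X j \<in> borel_measurable M" if "j \<in> {2..n}" for j using D(3)[of j] that by auto
  have mX1 [measurable]: "X 1 \<in> borel_measurable M" using mX[of 1] n by auto
  have "0 \<le> \<sigma>" "0 \<le> \<alpha>" "0 \<le> \<tau>"
    using \<beta> \<epsilon> by (auto simp: \<sigma>_def \<alpha>_def \<tau>_def)
  define w where "w k = (vector [cos (2 * pi * real k / real n), sin (2 * pi * real k / real n)] :: real ^ 2)" for k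
  have w: "norm (w k) = 1" for k by (simp add: w_def norm_vec_def L2_set_def sum_2)
  define r where "r = 1 - 5 * \<epsilon>"
  define miss where "miss k = {\<omega> \<in> space M. \<forall>j\<in>{2..n}. X j \<omega> \<notin> cap (w k) \<epsilon>}" for k
  \<comment> \<open>The product of \<open>f (X 1 \<omega>) (X j \<omega>)\<close> over
    \<open>j\<close> is \<open>exp (N / L)\<close>, with \<open>N\<close> the number of points near
    \<open>X 1 \<omega>\<close>.\<close>
  define f where "f x y = (if norm y \<le> 1 \<and> 2 * r \<le> norm (x + y) then ennreal (exp (1 / L)) else 1)"
    for x y :: "real ^ 2"
  define g :: "real ^ 2 \<Rightarrow> ennreal" where "g = indicator {x. r < norm x \<and> norm x \<le> 1}"
  have [measurable]: "g \<in> borel_measurable borel" unfolding g_def by measurable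
  have f [measurable]: "case_prod f \<in> borel_measurable (borel \<Otimes>\<^sub>M borel)"
    unfolding f_def case_prod_beta by measurable
  have f_meas: "(\<lambda>\<omega>. f (X 1 \<omega>) (X j \<omega>)) \<in> borel_measurable M" if "j \<in> {2..n}" for j
  proof -
    have [measurable]: "X j \<in> borel_measurable M" by (rule mX2[OF that])
    show ?thesis by measurable
  qed
  have gf [measurable]: "(\<lambda>\<omega>. g (X 1 \<omega>) * (\<Prod>j\<in>{2..n}. f (X 1 \<omega>) (X j \<omega>))) \<in> borel_measurable M"
    by (intro borel_measurable_times_ennreal borel_measurable_prod_ennreal f_meas) measurable
  have miss [measurable]: "miss k \<in> sets M" for k unfolding miss_def by measurable
  have miss_le: "emeasure M (miss k) \<le> ennreal ((1 - \<tau>) ^ (n - 1))" for k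
    unfolding miss_def \<tau>_def
    using \<beta> \<epsilon> by (intro emeasure_random_sample_avoids[OF S n] emeasure_cap_ge w) auto
  \<comment> \<open>As a lower bound for a probability, \<open>\<tau>\<close> is at most 1, so the
    powers of \<open>1 - \<tau>\<close> are nonnegative.\<close>
  have "emeasure (beta_law \<beta>) (cap (w 0) \<epsilon>) \<le> 1" by (rule \<mu>.emeasure_le_1)
  moreover have "ennreal \<tau> \<le> emeasure (beta_law \<beta>) (cap (w 0) \<epsilon>)"
    unfolding \<tau>_def using \<beta> \<epsilon> by (intro emeasure_cap_ge w) auto
  ultimately have "ennreal \<tau> \<le> 1" by (rule order_trans[rotated])
  then have "\<tau> \<le> 1" by simp
  have nonneg: "0 \<le> ?bad" "0 \<le> ?good"
    using \<open>\<tau> \<le> 1\<close> \<open>0 \<le> \<sigma>\<close> \<open>0 \<le> \<alpha>\<close> L by (auto intro!: mult_nonneg_nonneg zero_le_power add_nonneg_nonneg)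

  \<comment> \<open>\<open>B\<close> dominates the p-th power where some cap is missed,
    \<open>G\<close> where all caps are hit.\<close>
  define B where "B \<omega> = (\<Sum>k<n. ennreal (real n ^ p) * indicator (miss k) \<omega>)" for \<omega>
  define G where "G \<omega> = ennreal (fact p * L ^ p * exp (1 / L)) *
    (g (X 1 \<omega>) * (\<Prod>j\<in>{2..n}. f (X 1 \<omega>) (X j \<omega>)))" for \<omega>
  have "AE \<omega> in M. \<forall>j\<in>{1..n}. norm (X j \<omega>) \<le> 1"
  proof (intro AE_finite_allI)
    fix j assume j: "j \<in> {1..n}"
    have "AE y in distr M borel (X j). norm y \<le> 1" unfolding D(4)[OF j] by (rule AE_beta_law)
    then show "AE \<omega> in M. norm (X j \<omega>) \<le> 1" using mX[OF j] by (subst (asm) AE_distr_iff) auto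
  qed simp
  then have ptw: "AE \<omega> in M. ennreal (\<bar>Df0 n (\<lambda>i. X i \<omega>)\<bar> ^ p) \<le> B \<omega> + G \<omega>"
  proof (rule AE_mp, intro AE_I2 impI)
    fix \<omega> assume \<omega>: "\<omega> \<in> space M" and norm: "\<forall>j\<in>{1..n}. norm (X j \<omega>) \<le> 1"
    let ?x = "\<lambda>i. X i \<omega>"
    show "ennreal (\<bar>Df0 n ?x\<bar> ^ p) \<le> B \<omega> + G \<omega>"
    proof (cases "\<exists>k<n. \<omega> \<in> miss k")
      case True
      then obtain k where k: "k < n" "\<omega> \<in> miss k" by blast
      have "ennreal (\<bar>Df0 n ?x\<bar> ^ p) \<le> ennreal (real n ^ p) * indicator (miss k) \<omega>"
        using k Df0_le[OF n, of ?x] by (simp add: power_mono)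
      also have "\<dots> \<le> B \<omega>"
        unfolding B_def using k by (intro member_le_sum) auto
      also have "\<dots> \<le> B \<omega> + G \<omega>" by simp
      finally show ?thesis .
    next
      case False
      have "cball 0 r \<subseteq> convex hull (?x ` {2..n})"
        unfolding r_def
      proof (rule cball_subset_convex_hull_if_caps_hit)
        fix k assume "k < n"
        then have "\<omega> \<notin> miss k" using False by blast
        then show "?x ` {2..n} \<inter> cap (vector [cos (2 * pi * real k / real n), sin (2 * pi * real k / real n)]) \<epsilon> \<noteq> {}"
          using \<omega> unfolding miss_def w_def by blast
      qed (use n \<epsilon> in auto)
      then have Df: "\<bar>Df0 n ?x\<bar> \<le> (if norm (?x 1) \<le> r then 0
          else 1 + real (card {j \<in> {2..n}. norm (?x j) \<le> 1 \<and> 2 * r \<le> norm (?x 1 + ?x j)}))"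
        using norm by (intro Df0_le_near_pairs[OF n]) auto
      have "ennreal (\<bar>Df0 n ?x\<bar> ^ p) \<le> G \<omega>"
      proof (cases "norm (?x 1) \<le> r")
        case True
        \<comment> \<open>The difference is 0 here, and \<open>p \<ge> 1\<close> excludes
          \<open>0 ^ 0 = 1\<close>.\<close>
        then show ?thesis using Df p by (simp add: power_0_left)
      next
        case False
        let ?J = "{j \<in> {2..n}. norm (?x j) \<le> 1 \<and> 2 * r \<le> norm (?x 1 + ?x j)}"
        let ?c = "real (card ?J)"
        have "\<bar>Df0 n ?x\<bar> ^ p \<le> (1 + ?c) ^ p"
          using Df False by (intro power_mono) auto
        also have "\<dots> = L ^ p * ((1 + ?c) / L) ^ p"
          using L by (simp add: power_divide)
        also have "\<dots> \<le> L ^ p * (fact p * exp ((1 + ?c) / L))"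
          using L by (intro mult_left_mono power_le_fact_exp) auto
        also have "\<dots> = (fact p * L ^ p * exp (1 / L)) * exp (1 / L) ^ card ?J"
          by (simp add: add_divide_distrib exp_add exp_of_nat_mult[symmetric])
        finally have "ennreal (\<bar>Df0 n ?x\<bar> ^ p)
            \<le> ennreal (fact p * L ^ p * exp (1 / L)) * ennreal (exp (1 / L) ^ card ?J)"
          using L by (subst ennreal_mult[symmetric]) (auto intro!: ennreal_leI)
        also have "ennreal (exp (1 / L) ^ card ?J) = (\<Prod>j\<in>{2..n}. f (?x 1) (?x j))"
          unfolding f_def by (simp add: prod.If_cases Int_def ennreal_power)
        also have "\<dots> = g (?x 1) * (\<Prod>j\<in>{2..n}. f (?x 1) (?x j))"
          using False norm n by (simp add: g_def)
        finally show ?thesis unfolding G_def .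
      qed
      also have "\<dots> \<le> B \<omega> + G \<omega>" by simp
      finally show ?thesis .
    qed
  qed
  have "(\<integral>\<^sup>+ \<omega>. B \<omega> \<partial>M) = (\<Sum>k<n. ennreal (real n ^ p) * emeasure M (miss k))"
    unfolding B_def by (subst nn_integral_sum) (auto simp: nn_integral_cmult_indicator)
  also have "\<dots> \<le> (\<Sum>k<n. ennreal (real n ^ p) * ennreal ((1 - \<tau>) ^ (n - 1)))"
    by (intro sum_mono mult_left_mono miss_le) simp
  also have "\<dots> = ennreal ?bad"
    using \<open>\<tau> \<le> 1\<close> by (simp add: ennreal_mult ennreal_of_nat_eq_real_of_nat mult_ac)
  finally have intB: "(\<integral>\<^sup>+ \<omega>. B \<omega> \<partial>M) \<le> ennreal ?bad" .

  have "(\<integral>\<^sup>+ x. g x * (\<integral>\<^sup>+ y. f x y \<partial>beta_law \<beta>) ^ (n - 1) \<partial>beta_law \<beta>)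
      \<le> (\<integral>\<^sup>+ x. ennreal ((1 + (exp (1 / L) - 1) * \<sigma>) ^ (n - 1)) * g x \<partial>beta_law \<beta>)"
  proof (intro nn_integral_mono)
    fix x
    show "g x * (\<integral>\<^sup>+ y. f x y \<partial>beta_law \<beta>) ^ (n - 1)
      \<le> ennreal ((1 + (exp (1 / L) - 1) * \<sigma>) ^ (n - 1)) * g x"
    proof (cases "r < norm x \<and> norm x \<le> 1")
      case True
      let ?N = "{y. norm y \<le> 1 \<and> 2 * r \<le> norm (x + y)}"
      have "x \<noteq> 0" using True \<epsilon> by (auto simp: r_def)
      have "?N \<subseteq> cap (x /\<^sub>R norm x) (20 * \<epsilon>)"
        using True near_pairs_subset_cap[OF \<epsilon>(1,2), of x] by (simp add: r_def)
      then have "emeasure (beta_law \<beta>) ?N \<le> emeasure (beta_law \<beta>) (cap (x /\<^sub>R norm x) (20 * \<epsilon>))"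
        by (intro emeasure_mono) auto
      also have "\<dots> \<le> ennreal \<sigma>"
        unfolding \<sigma>_def using \<epsilon> \<open>x \<noteq> 0\<close> by (intro emeasure_cap_le[OF \<beta>]) auto
      finally have N: "emeasure (beta_law \<beta>) ?N \<le> ennreal \<sigma>" .
      \<comment> \<open>Writing \<open>f x\<close> as 1 plus a multiple of an indicator gives its
        integral in terms of the measure of the near set.\<close>
      have "ennreal (exp (1 / L)) = 1 + ennreal (exp (1 / L) - 1)"
        using L ennreal_plus[of 1 "exp (1 / L) - 1"] by simp
      then have "f x y = 1 + ennreal (exp (1 / L) - 1) * indicator ?N y" for y
        by (simp add: f_def)
      then have "(\<integral>\<^sup>+ y. f x y \<partial>beta_law \<beta>)
          = (\<integral>\<^sup>+ y. 1 + ennreal (exp (1 / L) - 1) * indicator ?N y \<partial>beta_law \<beta>)"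
        by simp
      also have "\<dots> = 1 + ennreal (exp (1 / L) - 1) * emeasure (beta_law \<beta>) ?N"
        by (subst nn_integral_add) (auto simp: nn_integral_cmult_indicator \<mu>.emeasure_space_1[simplified])
      also have "\<dots> \<le> 1 + ennreal (exp (1 / L) - 1) * ennreal \<sigma>"
        by (intro add_left_mono mult_left_mono N) simp
      also have "\<dots> = ennreal (1 + (exp (1 / L) - 1) * \<sigma>)"
        using L \<open>0 \<le> \<sigma>\<close> by (simp add: ennreal_plus ennreal_mult)
      finally have "(\<integral>\<^sup>+ y. f x y \<partial>beta_law \<beta>) ^ (n - 1) \<le> ennreal (1 + (exp (1 / L) - 1) * \<sigma>) ^ (n - 1)"
        by (intro power_mono) auto
      also have "\<dots> = ennreal ((1 + (exp (1 / L) - 1) * \<sigma>) ^ (n - 1))"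
        using L \<open>0 \<le> \<sigma>\<close> by (intro ennreal_power) auto
      finally show ?thesis using True by (simp add: g_def)
    qed (simp add: g_def)
  qed
  also have "\<dots> = ennreal ((1 + (exp (1 / L) - 1) * \<sigma>) ^ (n - 1))
      * emeasure (beta_law \<beta>) {x. r < norm x \<and> norm x \<le> 1}"
    unfolding g_def by (intro nn_integral_cmult_indicator) measurable
  also have "\<dots> \<le> ennreal ((1 + (exp (1 / L) - 1) * \<sigma>) ^ (n - 1)) * ennreal \<alpha>"
    unfolding r_def \<alpha>_def using \<epsilon> by (intro mult_left_mono emeasure_annulus_le[OF \<beta>]) auto
  also have "\<dots> = ennreal (\<alpha> * (1 + (exp (1 / L) - 1) * \<sigma>) ^ (n - 1))"
    using L \<open>0 \<le> \<alpha>\<close> \<open>0 \<le> \<sigma>\<close> by (subst ennreal_mult[symmetric]) (auto simp: mult.commute)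
  finally have "(\<integral>\<^sup>+ \<omega>. g (X 1 \<omega>) * (\<Prod>j\<in>{2..n}. f (X 1 \<omega>) (X j \<omega>)) \<partial>M)
      \<le> ennreal (\<alpha> * (1 + (exp (1 / L) - 1) * \<sigma>) ^ (n - 1))"
    by (subst nn_integral_random_sample_prod[OF S n _ f]) auto
  then have "(\<integral>\<^sup>+ \<omega>. G \<omega> \<partial>M) \<le> ennreal (fact p * L ^ p * exp (1 / L))
      * ennreal (\<alpha> * (1 + (exp (1 / L) - 1) * \<sigma>) ^ (n - 1))"
    unfolding G_def by (subst nn_integral_cmult[OF gf]) (intro mult_left_mono, auto)
  also have "\<dots> = ennreal ?good"
    using L \<open>0 \<le> \<alpha>\<close> \<open>0 \<le> \<sigma>\<close> by (intro ennreal_mult[symmetric]) auto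
  finally have intG: "(\<integral>\<^sup>+ \<omega>. G \<omega> \<partial>M) \<le> ennreal ?good" .

  have mB: "B \<in> borel_measurable M" unfolding B_def by measurable
  have mG: "G \<in> borel_measurable M" unfolding G_def by measurable
  have "(\<integral>\<^sup>+ \<omega>. ennreal (\<bar>Df0 n (\<lambda>i. X i \<omega>)\<bar> ^ p) \<partial>M) \<le> (\<integral>\<^sup>+ \<omega>. B \<omega> + G \<omega> \<partial>M)"
    by (rule nn_integral_mono_AE[OF ptw])
  also have "\<dots> = (\<integral>\<^sup>+ \<omega>. B \<omega> \<partial>M) + (\<integral>\<^sup>+ \<omega>. G \<omega> \<partial>M)"
    by (rule nn_integral_add[OF mB mG])
  also have "\<dots> \<le> ennreal (?bad + ?good)"
    using intB intG nonneg by (simp add: ennreal_plus add_mono)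
  finally have le: "(\<integral>\<^sup>+ \<omega>. ennreal (\<bar>Df0 n (\<lambda>i. X i \<omega>)\<bar> ^ p) \<partial>M) \<le> ennreal (?bad + ?good)" .
  \<comment> \<open>The Bochner integral of a non-integrable function is \<open>0\<close>, so measurability of \<open>f0\<close> is not an issue.\<close>
  show ?thesis
  proof (cases "integrable M (\<lambda>\<omega>. \<bar>Df0 n (\<lambda>i. X i \<omega>)\<bar> ^ p)")
    case True
    then have "ennreal (M.expectation (\<lambda>\<omega>. \<bar>Df0 n (\<lambda>i. X i \<omega>)\<bar> ^ p)) \<le> ennreal (?bad + ?good)"
      using le by (simp add: nn_integral_eq_integral)
    then show ?thesis using ennreal_le_iff[OF add_nonneg_nonneg[OF nonneg]] by blast
  next
    case False
    then show ?thesis using nonneg by (simp add: not_integrable_integral_eq)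
  qed
qed

section \<open>Choice of parameters for large samples\<close>

lemma expectation_Df0_asymp_le:
  fixes p n :: nat and \<beta> c\<tau> c\<sigma> c\<alpha> A :: real
  assumes S: "random_sample (beta_law \<beta>) n M X" and p: "p \<ge> 1"
    and q: "3 \<le> q" and \<beta>: "\<beta> = q / 2 - 3 / 2"
    and c\<tau>: "c\<tau> = (\<beta> + 1) / pi * (1 / 2) powr \<beta> * (1 / 2)"
    and c\<sigma>: "c\<sigma> = (\<beta> + 1) / pi * 40 powr \<beta> * (40 * sqrt 40)"
    and c\<alpha>: "c\<alpha> = (\<beta> + 1) / pi * 10 powr \<beta> * (10 * pi)"
    and A: "A = 2 * (real p + 2) / c\<tau>"
    and n: "n \<ge> 80" "1 \<le> ln (real n)" "1 \<le> A * ln (real n)"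
      "2 * (real p + 2) * ln (real n) / real n \<le> 1" "(A * ln (real n) / real n) powr (2 / q) \<le> 1 / 20"
  shows "prob_space.expectation M (\<lambda>\<omega>. \<bar>Df0 n (\<lambda>i. X i \<omega>)\<bar> ^ p)
    \<le> (1 + fact p * exp 1 * c\<alpha> * A powr (1 - 1 / q) * exp (2 * c\<sigma> * A))
      * ln (real n) powr (real p + 1 - 1 / q) * (1 / real n) powr (1 - 1 / q)"
proof -
  define L where "L = ln (real n)"
  \<comment> \<open>With \<open>q\<close> in the role of \<open>d - 1\<close>, cap measures scale as
    \<open>\<epsilon> powr (q / 2)\<close>, so this choice makes them multiples of
    \<open>A * L / n\<close>. The constants \<open>c\<tau>\<close>, \<open>c\<sigma>\<close>,
    \<open>c\<alpha>\<close> are what remains of \<open>\<tau>\<close>, \<open>\<sigma>\<close>,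
    \<open>\<alpha>\<close> once the powers of \<open>\<epsilon>\<close> are taken out.\<close>
  define \<epsilon> where "\<epsilon> = (A * L / real n) powr (2 / q)"
  have n0: "real n \<ge> 80" "n \<ge> 1" using n by auto
  have L: "1 \<le> L" "1 \<le> A * L" using n by (auto simp: L_def)
  have \<beta>0: "0 \<le> \<beta>" using q \<beta> by simp
  have c\<tau>0: "0 < c\<tau>" unfolding c\<tau> using \<beta>0 by simp
  have c\<sigma>0: "0 \<le> c\<sigma>" unfolding c\<sigma> using \<beta>0 by simp
  have c\<alpha>0: "0 \<le> c\<alpha>" unfolding c\<alpha> using \<beta>0 by simp
  have A0: "0 < A" unfolding A using c\<tau>0 by simp
  have \<epsilon>0: "0 < \<epsilon>" unfolding \<epsilon>_def using A0 L n0 by simp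
  have \<epsilon>20: "\<epsilon> \<le> 1 / 20" using n by (simp add: \<epsilon>_def L_def)
  have net: "(4 * pi / real n)\<^sup>2 \<le> 2 * \<epsilon>"
  proof -
    \<comment> \<open>The bound \<open>n \<ge> 80\<close> enters through
      \<open>8 * pi\<^sup>2 < 80\<close>; then \<open>1 / n \<le> \<epsilon>\<close> because
      \<open>2 / q \<le> 1\<close> and \<open>A * L \<ge> 1\<close>.\<close>
    have "pi\<^sup>2 \<le> (3.15)\<^sup>2" using pi_approx by (intro power_mono) auto
    then have "8 * pi\<^sup>2 \<le> real n" using n0 by (simp add: power2_eq_square)
    then have "8 * pi\<^sup>2 / (real n)\<^sup>2 \<le> real n / (real n)\<^sup>2"
      by (intro divide_right_mono) auto
    then have "8 * pi\<^sup>2 / (real n)\<^sup>2 \<le> 1 / real n" using n0 by (simp add: power2_eq_square)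
    also have "1 / real n = (1 / real n) powr 1" using n0 by simp
    also have "\<dots> \<le> (1 / real n) powr (2 / q)" using n0 q by (intro powr_mono') auto
    also have "\<dots> \<le> \<epsilon>"
      unfolding \<epsilon>_def using L n0 q by (intro powr_mono2 divide_right_mono) auto
    finally show ?thesis by (simp add: power_divide power_mult_distrib)
  qed
  have \<epsilon>q: "\<epsilon> powr \<beta> * (\<epsilon> * sqrt \<epsilon>) = A * L / n"
  proof -
    have "\<epsilon> powr \<beta> * (\<epsilon> * sqrt \<epsilon>) = \<epsilon> powr \<beta> * (\<epsilon> powr 1 * \<epsilon> powr (1 / 2))"
      using \<epsilon>0 by (simp add: powr_half_sqrt)
    also have "\<dots> = \<epsilon> powr (q / 2)"
      unfolding powr_add[symmetric] by (simp add: \<beta>)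
    also have "\<dots> = A * L / n"
      unfolding \<epsilon>_def powr_powr using q A0 L n0 by simp
    finally show ?thesis .
  qed
  have \<epsilon>\<alpha>: "\<epsilon> powr \<beta> * \<epsilon> = (A * L / n) powr (1 - 1 / q)"
  proof -
    have "\<epsilon> powr \<beta> * \<epsilon> = \<epsilon> powr (\<beta> + 1)"
      using \<epsilon>0 by (simp add: powr_add)
    also have "\<dots> = (A * L / n) powr (2 / q * (\<beta> + 1))"
      unfolding \<epsilon>_def powr_powr by simp
    also have "2 / q * (\<beta> + 1) = 1 - 1 / q"
      using q by (simp add: \<beta> field_simps)
    finally show ?thesis .
  qed
  define \<tau> where "\<tau> = (\<beta> + 1) / pi * (\<epsilon> / 2) powr \<beta> * (\<epsilon> / 2 * sqrt \<epsilon>)"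
  define \<sigma> where "\<sigma> = (\<beta> + 1) / pi * (2 * (20 * \<epsilon>)) powr \<beta> * (20 * \<epsilon> * (2 * sqrt (2 * (20 * \<epsilon>))))"
  define \<alpha> where "\<alpha> = (\<beta> + 1) / pi * (2 * (5 * \<epsilon>)) powr \<beta> * (2 * pi * (5 * \<epsilon>))"
  have "\<tau> = c\<tau> * (\<epsilon> powr \<beta> * (\<epsilon> * sqrt \<epsilon>))"
    using \<epsilon>0 powr_mult[of \<epsilon> "1 / 2" \<beta>] unfolding \<tau>_def c\<tau> by simp
  also have "\<dots> = 2 * (real p + 2) * L / n"
    unfolding \<epsilon>q A using c\<tau>0 by simp
  finally have \<tau>: "\<tau> = 2 * (real p + 2) * L / n" .
  have "\<sigma> = c\<sigma> * (\<epsilon> powr \<beta> * (\<epsilon> * sqrt \<epsilon>))"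
    using \<epsilon>0 powr_mult[of 40 \<epsilon> \<beta>] real_sqrt_mult[of 40 \<epsilon>] unfolding \<sigma>_def c\<sigma>
    by (simp del: real_sqrt_mult)
  then have \<sigma>: "\<sigma> = c\<sigma> * (A * L / n)" unfolding \<epsilon>q .
  have "\<alpha> = c\<alpha> * (\<epsilon> powr \<beta> * \<epsilon>)"
    using \<epsilon>0 powr_mult[of 10 \<epsilon> \<beta>] unfolding \<alpha>_def c\<alpha> by simp
  then have \<alpha>: "\<alpha> = c\<alpha> * (A * L / n) powr (1 - 1 / q)" unfolding \<epsilon>\<alpha> .
  have \<tau>01: "0 \<le> \<tau>" "\<tau> \<le> 1" using \<tau> n L by (auto simp: L_def)
  have expL: "exp L = n" using n0 by (simp add: L_def)

  \<comment> \<open>Since \<open>n - 1 \<ge> n / 2\<close>, the factor 2 in \<open>A\<close> yields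
    decay \<open>n ^ (p + 2)\<close>: this beats the trivial bound \<open>n ^ p\<close> and the
    \<open>n\<close> caps with one power of \<open>n\<close> to spare.\<close>
  have "(1 - \<tau>) ^ (n - 1) \<le> exp (- \<tau>) ^ (n - 1)"
    using \<tau>01 exp_ge_add_one_self[of "- \<tau>"] by (intro power_mono) auto
  also have "\<dots> = exp (- (\<tau> * real (n - 1)))"
    by (simp add: exp_of_nat_mult[symmetric] mult.commute)
  also have "\<dots> \<le> exp (- ((real p + 2) * L))"
  proof -
    have "\<tau> * (real n / 2) \<le> \<tau> * real (n - 1)"
      using n0 \<tau>01 by (intro mult_left_mono) (auto simp: of_nat_diff)
    moreover have "\<tau> * (real n / 2) = (real p + 2) * L" using n0 by (simp add: \<tau>)
    ultimately show ?thesis by simp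
  qed
  also have "\<dots> = inverse (exp L ^ (p + 2))"
    unfolding exp_of_nat_mult[symmetric] exp_minus[symmetric] by simp
  also have "\<dots> = 1 / real n ^ (p + 2)"
    unfolding expL by (simp add: inverse_eq_divide)
  finally have "real n ^ p * (real n * (1 - \<tau>) ^ (n - 1)) \<le> real n ^ p * (real n * (1 / real n ^ (p + 2)))"
    by (intro mult_left_mono) auto
  also have "\<dots> = (1 / real n) powr 1"
    using n0 by (simp add: field_simps)
  also have "\<dots> \<le> (1 / real n) powr (1 - 1 / q)"
    using n0 q by (intro powr_mono') auto
  also have "\<dots> \<le> L powr (real p + 1 - 1 / q) * (1 / real n) powr (1 - 1 / q)"
  proof -
    have "1 / q \<le> 1" using q by simp
    then have "0 \<le> real p + 1 - 1 / q" by linarith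
    then have "1 \<le> L powr (real p + 1 - 1 / q)"
      using L by (intro ge_one_powr_ge_zero) auto
    then show ?thesis using mult_right_mono by fastforce
  qed
  finally have bad: "real n ^ p * (real n * (1 - \<tau>) ^ (n - 1))
    \<le> L powr (real p + 1 - 1 / q) * (1 / real n) powr (1 - 1 / q)" .

  \<comment> \<open>The rate \<open>1 / L\<close> is matched to
    \<open>\<sigma> * n = c\<sigma> * A * L\<close>: the factors \<open>L\<close> cancel and the
    exponential moment stays below a constant.\<close>
  have exp1: "exp (1 / L) - 1 \<le> 2 / L"
  proof -
    have "exp (1 / L) \<le> 1 + 1 / L + (1 / L)\<^sup>2" using L by (intro exp_bound) auto
    moreover have "(1 / L)\<^sup>2 \<le> 1 / L" using L by (simp add: power2_eq_square field_simps)
    ultimately show ?thesis by simp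
  qed
  have \<sigma>0: "0 \<le> \<sigma>" unfolding \<sigma> using c\<sigma>0 A0 L by simp
  have "(1 + (exp (1 / L) - 1) * \<sigma>) ^ (n - 1) \<le> (1 + 2 / L * \<sigma>) ^ (n - 1)"
    using exp1 \<sigma>0 L by (intro power_mono add_left_mono mult_right_mono) auto
  also have "\<dots> \<le> exp (2 / L * \<sigma>) ^ (n - 1)"
    using \<sigma>0 L by (intro power_mono exp_ge_add_one_self) auto
  also have "\<dots> \<le> exp (2 / L * \<sigma>) ^ n"
    using \<sigma>0 L by (intro power_increasing) auto
  also have "\<dots> = exp (2 * c\<sigma> * A)"
    unfolding exp_of_nat_mult[symmetric] \<sigma> using L n0 by simp
  finally have pw: "(1 + (exp (1 / L) - 1) * \<sigma>) ^ (n - 1) \<le> exp (2 * c\<sigma> * A)" .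
  have "fact p * L ^ p * exp (1 / L) * (\<alpha> * (1 + (exp (1 / L) - 1) * \<sigma>) ^ (n - 1))
      \<le> fact p * L ^ p * exp 1 * (\<alpha> * exp (2 * c\<sigma> * A))"
    using pw L c\<alpha>0 \<sigma>0
    by (intro mult_mono mult_left_mono) (auto simp: \<alpha> intro!: mult_nonneg_nonneg zero_le_power add_nonneg_nonneg)
  also have "\<dots> = fact p * exp 1 * c\<alpha> * A powr (1 - 1 / q) * exp (2 * c\<sigma> * A)
      * L powr (real p + 1 - 1 / q) * (1 / real n) powr (1 - 1 / q)"
  proof -
    \<comment> \<open>The annulus contributes \<open>L powr (1 - 1 / q)\<close>, which joins
      \<open>L ^ p\<close> from the moment to give the exponent
      \<open>p + 1 - 1 / q\<close>.\<close>
    have "(A * L / n) powr (1 - 1 / q) = A powr (1 - 1 / q) * L powr (1 - 1 / q) * (1 / real n) powr (1 - 1 / q)"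
      using A0 L n0 by (simp add: powr_mult powr_divide)
    moreover have "L powr (real p + 1 - 1 / q) = L ^ p * L powr (1 - 1 / q)"
      using L powr_add[of L "real p" "1 - 1 / q"] by (simp add: powr_realpow algebra_simps)
    ultimately show ?thesis by (simp add: \<alpha>)
  qed
  finally have good: "fact p * L ^ p * exp (1 / L) * (\<alpha> * (1 + (exp (1 / L) - 1) * \<sigma>) ^ (n - 1))
    \<le> fact p * exp 1 * c\<alpha> * A powr (1 - 1 / q) * exp (2 * c\<sigma> * A)
      * L powr (real p + 1 - 1 / q) * (1 / real n) powr (1 - 1 / q)" .
  have "prob_space.expectation M (\<lambda>\<omega>. \<bar>Df0 n (\<lambda>i. X i \<omega>)\<bar> ^ p)
    \<le> real n ^ p * (real n * (1 - \<tau>) ^ (n - 1))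
      + fact p * L ^ p * exp (1 / L) * (\<alpha> * (1 + (exp (1 / L) - 1) * \<sigma>) ^ (n - 1))"
    unfolding \<tau>_def \<sigma>_def \<alpha>_def
    using L by (intro expectation_Df0_le[OF S n0(2) \<beta>0 \<epsilon>0 \<epsilon>20 net _ p]) simp
  also have "\<dots> \<le> (1 + fact p * exp 1 * c\<alpha> * A powr (1 - 1 / q) * exp (2 * c\<sigma> * A))
      * L powr (real p + 1 - 1 / q) * (1 / real n) powr (1 - 1 / q)"
    using add_mono[OF bad good] by (simp only: distrib_right mult_1)
  finally show ?thesis unfolding L_def .
qed

theorem theorem5p26:
  fixes d p :: nat
  assumes "d \<ge> 4" and "p \<ge> 1"
  shows "\<exists>c>0. \<forall>\<^sub>F n in sequentially.
    \<forall>(M :: 'a measure) X. random_sample (beta_law (beta_exponent d)) n M X \<longrightarrow>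
      prob_space.expectation M (\<lambda>\<omega>. \<bar>Df0 n (\<lambda>i. X i \<omega>)\<bar> ^ p)
        \<le> c * ln (real n) powr (real p + 1 - 1 / (real d - 1))
            * (1 / real n) powr (1 - 1 / (real d - 1))"
proof -
  define q \<beta> where "q = real d - 1" and "\<beta> = beta_exponent d"
  define c\<tau> where "c\<tau> = (\<beta> + 1) / pi * (1 / 2) powr \<beta> * (1 / 2)"
  define c\<sigma> where "c\<sigma> = (\<beta> + 1) / pi * 40 powr \<beta> * (40 * sqrt 40)"
  define c\<alpha> where "c\<alpha> = (\<beta> + 1) / pi * 10 powr \<beta> * (10 * pi)"
  define A where "A = 2 * (real p + 2) / c\<tau>"
  have q: "3 \<le> q" using assms by (simp add: q_def)
  have \<beta>: "\<beta> = q / 2 - 3 / 2" by (simp add: \<beta>_def q_def beta_exponent_def field_simps)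
  have "0 < c\<tau>" "0 < c\<alpha>" using q by (auto simp: c\<tau>_def c\<alpha>_def \<beta>)
  then have A: "0 < A" by (simp add: A_def)
  let ?c = "1 + fact p * exp 1 * c\<alpha> * A powr (1 - 1 / q) * exp (2 * c\<sigma> * A)"
  have nonneg: "\<forall>\<^sub>F n in sequentially. 0 \<le> A * ln (real n) / real n" using A by real_asymp
  have "((\<lambda>n. A * ln (real n) / real n) \<longlongrightarrow> 0) sequentially" by real_asymp
  then have "((\<lambda>n. (A * ln (real n) / real n) powr (2 / q)) \<longlongrightarrow> 0) sequentially"
    using q nonneg by (intro tendsto_zero_powrI[where b = "2 / q"]) auto
  then have e5: "\<forall>\<^sub>F n in sequentially. (A * ln (real n) / real n) powr (2 / q) < 1 / 20"
    by (rule order_tendstoD) simp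
  have "((\<lambda>n. 2 * (real p + 2) * ln (real n) / real n) \<longlongrightarrow> 0) sequentially" by real_asymp
  then have e4: "\<forall>\<^sub>F n in sequentially. 2 * (real p + 2) * ln (real n) / real n < 1"
    by (rule order_tendstoD) simp
  have e3: "\<forall>\<^sub>F n in sequentially. 1 \<le> A * ln (real n)" using A by real_asymp
  have e2: "\<forall>\<^sub>F n in sequentially. 1 \<le> ln (real n)" by real_asymp
  have e1: "\<forall>\<^sub>F n in sequentially. (80 :: nat) \<le> n" by (rule eventually_ge_at_top)
  \<comment> \<open>The five conditions on \<open>n\<close> depend only on \<open>d\<close> and
    \<open>p\<close>, so one threshold serves all \<open>M\<close> and \<open>X\<close>.\<close>
  have "\<forall>\<^sub>F n in sequentially. \<forall>(M :: 'a measure) X. random_sample (beta_law (beta_exponent d)) n M X \<longrightarrow>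
      prob_space.expectation M (\<lambda>\<omega>. \<bar>Df0 n (\<lambda>i. X i \<omega>)\<bar> ^ p)
        \<le> ?c * ln (real n) powr (real p + 1 - 1 / q) * (1 / real n) powr (1 - 1 / q)"
    using e1 e2 e3 e4 e5
  proof eventually_elim
    case (elim n)
    then show ?case
      using expectation_Df0_asymp_le[OF _ assms(2) q \<beta> c\<tau>_def c\<sigma>_def c\<alpha>_def A_def, of n]
      by (auto simp: \<beta>_def)
  qed
  moreover have "0 < ?c" using \<open>0 < c\<alpha>\<close> by (simp add: add_pos_nonneg)
  ultimately show ?thesis unfolding q_def by blast
qed

end
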